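(* Let $T\subset\mathbb{R}^3$ be a regular tetrahedron with edge length $1$ and let $-T=\{-x:x\in T\}$. Then the volume ratio $$a\longmapsto\frac{\operatorname{Vol}\left(aT+\frac{1-a}{2}(-T)\right)}{\operatorname{Vol}(T)},\qquad a\in[0,1],$$ attains its maximum over $[0,1]$ at $a=\frac{1+2\sqrt{14}}{11}\approx 0.77121003$, and the maximum value of this ratio is approximately $1.1633587$.
   Context: For sets $X,Y\subset\mathbb{R}^3$ and real $a,b$, $aX+bY=\{ax+by: x\in X, y\in Y\}$ (scaled Minkowski sum). $\operatorname{Vol}$ is three-dimensional volume (Lebesgue measure). The set $aT+\frac{1-a}{2}(-T)=aT+(1-a)\left(-\frac12T\right)$ is the Minkowski interpolation between $T$ and the inverted tetrahedron $-\frac12 T$ of edge length $\frac12$. The numerical approximations are understood as agreement with the exact value to within $10^{-6}$. *)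

theory Defs
  imports "HOL-Analysis.Analysis"
begin

text \<open>Four pairwise equidistant points in space with positive common distance are automatically
  affinely independent, so no non-degeneracy condition is needed.\<close>

definition regular_tetrahedron :: "real \<Rightarrow> (real ^ 3) set \<Rightarrow> bool" where
  "regular_tetrahedron s T \<longleftrightarrow>
     s > 0 \<and>
     (\<exists>V. card V = 4 \<and> (\<forall>p\<in>V. \<forall>q\<in>V. p \<noteq> q \<longrightarrow> dist p q = s) \<and> T = convex hull V)"

definition scaled_minkowski_sum ::
    "real \<Rightarrow> (real ^ 3) set \<Rightarrow> real \<Rightarrow> (real ^ 3) set \<Rightarrow> (real ^ 3) set" where
  "scaled_minkowski_sum a X b Y = {a *\<^sub>R x + b *\<^sub>R y | x y. x \<in> X \<and> y \<in> Y}"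

definition volume_ratio :: "(real ^ 3) set \<Rightarrow> real \<Rightarrow> real" where
  "volume_ratio T a =
     measure lebesgue (scaled_minkowski_sum a T ((1 - a) / 2) (uminus ` T)) / measure lebesgue T"

end

theory Submission
  imports Defs
begin

text \<open>The ratio is invariant under affine bijections, so \<open>T\<close> may be replaced by the standard simplex
  \<open>S\<close>. A point belongs to \<open>aS - bS\<close> iff the coordinates of its positive part sum to at most
  \<open>a\<close> and those of its negative part to at most \<open>b\<close>. Hence the coordinate planes cut \<open>aS - bS\<close> into
  copies of \<open>aS\<close> and \<open>bS\<close> and six triangular prisms, which gives the ratio
  \<open>a\<^sup>3 + 9a\<^sup>2b + 9ab\<^sup>2 + b\<^sup>3\<close> with \<open>b = (1 - a)/2\<close>. This is a cubic in \<open>a\<close>, whose difference to its value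
  at the critical point \<open>a0\<close> has the factor \<open>(a - a0)\<^sup>2\<close>.\<close>

section \<open>Volumes under cutting and reflection\<close>

text \<open>The two pieces overlap only in the hyperplane \<open>c \<bullet> x = t\<close>, which is
  null because \<open>c\<close> is nonzero. Compactness of \<open>A\<close> makes both pieces
  measurable.\<close>

lemma measure_split_halfspaces:
  fixes A :: "'a::euclidean_space set"
  assumes "compact A" "c \<noteq> 0"
  shows "measure lebesgue A
    = measure lebesgue (A \<inter> {x. t \<le> c \<bullet> x}) + measure lebesgue (A \<inter> {x. c \<bullet> x \<le> t})"
proof -
  have "A \<inter> {x. t \<le> c \<bullet> x} \<in> lmeasurable" "A \<inter> {x. c \<bullet> x \<le> t} \<in> lmeasurable"
    using assms
    by (auto intro!: lmeasurable_compact compact_Int_closed closed_halfspace_le closed_halfspace_ge)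
  moreover have "AE x in lebesgue. x \<notin> {x. c \<bullet> x = t}"
    using negligible_hyperplane[of c t] assms(2)
    by (intro AE_not_in) (simp add: negligible_iff_null_sets)
  hence "AE x in lebesgue. x \<notin> A \<inter> {x. t \<le> c \<bullet> x} \<or> x \<notin> A \<inter> {x. c \<bullet> x \<le> t}"
    by (rule AE_mp) auto
  ultimately have "measure lebesgue (A \<inter> {x. t \<le> c \<bullet> x} \<union> A \<inter> {x. c \<bullet> x \<le> t})
    = measure lebesgue (A \<inter> {x. t \<le> c \<bullet> x}) + measure lebesgue (A \<inter> {x. c \<bullet> x \<le> t})"
    by (intro measure_Un_AE) auto
  moreover have "A \<inter> {x. t \<le> c \<bullet> x} \<union> A \<inter> {x. c \<bullet> x \<le> t} = A"
    by auto
  ultimately show ?thesis by simp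
qed

lemma measure_split_component:
  fixes A :: "(real^'n) set"
  assumes "compact A"
  shows "measure lebesgue A
    = measure lebesgue (A \<inter> {x. 0 \<le> x $ i}) + measure lebesgue (A \<inter> {x. x $ i \<le> 0})"
  using measure_split_halfspaces[OF assms, of "axis i 1" 0] by (simp add: inner_axis' axis_eq_0_iff)

lemma measure_uminus_image:
  fixes A :: "'a::euclidean_space set"
  shows "measure lebesgue (uminus ` A) = measure lebesgue A"
  using measure_lebesgue_affine[of "-1" 0 A] by simp

section \<open>Triangular prisms\<close>

text \<open>The axes are parameters so that one volume computation serves all six octants of mixed
  sign.\<close>

definition prism :: "3 \<Rightarrow> 3 \<Rightarrow> 3 \<Rightarrow> real \<Rightarrow> real \<Rightarrow> (real^3) set" where
  "prism i j k a b = {x. 0 \<le> x $ i \<and> 0 \<le> x $ j \<and> x $ i + x $ j \<le> a \<and> - b \<le> x $ k \<and> x $ k \<le> 0}"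

text \<open>A point reflection exchanges the prism and its complement in a box, up to the common face.\<close>

lemma measure_prism:
  assumes ijk: "UNIV = {i, j, k}" "i \<noteq> j" "i \<noteq> k" "j \<noteq> k" and ab: "0 \<le> a" "0 \<le> b"
  shows "measure lebesgue (prism i j k a b) = a\<^sup>2 * b / 2"
proof -
  define l u :: "real^3" where "l = (\<chi> m. if m = k then - b else 0)"
    and "u = (\<chi> m. if m = k then 0 else a)"
  have lu: "l $ i = 0" "l $ j = 0" "l $ k = - b" "u $ i = a" "u $ j = a" "u $ k = 0"
    using ijk(2-4) by (auto simp: l_def u_def)
  have all: "(\<forall>m. P m) \<longleftrightarrow> P i \<and> P j \<and> P k" for P
    using ijk(1) by (metis UNIV_I insertE singletonD)
  have mem: "x \<in> cbox l u \<longleftrightarrow> 0 \<le> x $ i \<and> x $ i \<le> a \<and> 0 \<le> x $ j \<and> x $ j \<le> a \<and> - b \<le> x $ k \<and> x $ k \<le> 0"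
    for x by (auto simp: mem_box_cart all lu)
  define c :: "real^3" where "c = axis i 1 + axis j 1"
  have c: "c \<bullet> x = x $ i + x $ j" for x
    by (simp add: c_def inner_add_left inner_axis')
  have "c $ i \<noteq> 0" using ijk by (simp add: c_def axis_def)
  hence "c \<noteq> 0" by auto
  have "l \<in> cbox l u" using ab by (simp add: mem lu)
  hence "measure lebesgue (cbox l u) = (\<Prod>m\<in>{i,j,k}. u $ m - l $ m)"
    using content_cbox_cart[of l u] ijk(1) by auto
  also have "\<dots> = a\<^sup>2 * b"
    using ijk(2-4) by (simp add: lu power2_eq_square)
  finally have box: "measure lebesgue (cbox l u) = a\<^sup>2 * b" .
  have low: "cbox l u \<inter> {x. c \<bullet> x \<le> a} = prism i j k a b"
    by (auto simp: mem c prism_def)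
  \<comment> \<open>The map \<open>x \<mapsto> l + u - x\<close> preserves the box and turns
    \<open>x $ i + x $ j\<close> into \<open>2 * a\<close> minus that sum, so it swaps the two sides
    of the level \<open>a\<close>.\<close>
  have up: "cbox l u \<inter> {x. a \<le> c \<bullet> x} = (\<lambda>x. (-1) *\<^sub>R x + (l + u)) ` prism i j k a b"
  proof (intro equalityI subsetI)
    fix x assume x: "x \<in> cbox l u \<inter> {x. a \<le> c \<bullet> x}"
    have "l + u - x \<in> prism i j k a b"
      using x by (simp add: mem c prism_def lu)
    moreover have "x = (-1) *\<^sub>R (l + u - x) + (l + u)" by simp
    ultimately show "x \<in> (\<lambda>x. (-1) *\<^sub>R x + (l + u)) ` prism i j k a b" by (rule rev_image_eqI)
  next
    fix x assume "x \<in> (\<lambda>x. (-1) *\<^sub>R x + (l + u)) ` prism i j k a b"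
    thus "x \<in> cbox l u \<inter> {x. a \<le> c \<bullet> x}"
      by (auto simp: mem c prism_def lu)
  qed
  have "measure lebesgue (cbox l u \<inter> {x. a \<le> c \<bullet> x}) = measure lebesgue (prism i j k a b)"
    unfolding up using measure_lebesgue_affine[of "-1" "l+u" "prism i j k a b"] by (simp add: add_ac)
  thus ?thesis
    using measure_split_halfspaces[of "cbox l u" c a] \<open>c \<noteq> 0\<close> box low by simp
qed

section \<open>The standard simplex and its multiples\<close>

definition unit_simplex :: "(real^3) set" where
  "unit_simplex = convex hull (insert 0 Basis)"

lemma unit_simplex_eq:
  "unit_simplex = {x. 0 \<le> x $ 1 \<and> 0 \<le> x $ 2 \<and> 0 \<le> x $ 3 \<and> x $ 1 + x $ 2 + x $ 3 \<le> 1}"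
proof -
  have B: "(Basis :: (real^3) set) = range (\<lambda>i. axis i 1)"
    by (auto simp: Basis_vec_def)
  have "inj (\<lambda>i::3. axis i (1::real))"
    by (auto simp: inj_def axis_eq_axis)
  hence "(\<Sum>b\<in>Basis. x \<bullet> b) = (\<Sum>i\<in>UNIV. x $ i)" for x :: "real^3"
    unfolding B by (simp add: sum.reindex inner_axis)
  thus ?thesis
    unfolding unit_simplex_def std_simplex by (auto simp: B inner_axis sum_3 forall_3)
qed

lemma compact_unit_simplex: "compact unit_simplex"
  unfolding unit_simplex_def by (intro finite_imp_compact_convex_hull) auto

lemma measure_unit_simplex: "measure lebesgue unit_simplex = 1 / 6"
proof -
  have "unit_simplex \<in> sets lborel"
    using compact_unit_simplex by (simp add: borel_compact)
  hence "measure lebesgue unit_simplex = measure lborel unit_simplex" by simp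
  thus ?thesis
    unfolding unit_simplex_def content_std_simplex by (simp add: eval_nat_numeral)
qed

lemma scaled_unit_simplex_eq:
  assumes "0 \<le> a"
  shows "(\<lambda>x. a *\<^sub>R x) ` unit_simplex
    = {x. 0 \<le> x $ 1 \<and> 0 \<le> x $ 2 \<and> 0 \<le> x $ 3 \<and> x $ 1 + x $ 2 + x $ 3 \<le> a}" (is "_ = ?R")
proof (intro equalityI subsetI)
  fix x assume "x \<in> (\<lambda>x. a *\<^sub>R x) ` unit_simplex"
  then obtain y where y: "y \<in> unit_simplex" "x = a *\<^sub>R y" by auto
  hence "a * (y $ 1 + y $ 2 + y $ 3) \<le> a * 1"
    using assms by (intro mult_left_mono) (auto simp: unit_simplex_eq)
  thus "x \<in> ?R" using assms y by (auto simp: unit_simplex_eq algebra_simps)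
next
  fix x assume x: "x \<in> ?R"
  show "x \<in> (\<lambda>x. a *\<^sub>R x) ` unit_simplex"
  \<comment> \<open>Rescaling by \<open>1 / a\<close> requires \<open>a \<noteq> 0\<close>; for
    \<open>a = 0\<close> the inequalities leave only the origin.\<close>
  proof (cases "a = 0")
    case True
    hence "x = 0" using x by (auto simp: vec_eq_iff forall_3)
    moreover have "0 \<in> unit_simplex" by (simp add: unit_simplex_eq)
    ultimately show ?thesis by force
  next
    case False
    hence "(1 / a) *\<^sub>R x \<in> unit_simplex"
      using x assms by (auto simp: unit_simplex_eq field_simps)
    thus ?thesis using False by (intro image_eqI[of _ _ "(1 / a) *\<^sub>R x"]) auto
  qed
qed

lemma measure_scaled_unit_simplex:
  assumes "0 \<le> a"
  shows "measure lebesgue {x::real^3. 0 \<le> x $ 1 \<and> 0 \<le> x $ 2 \<and> 0 \<le> x $ 3 \<and> x $ 1 + x $ 2 + x $ 3 \<le> a}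
    = a ^ 3 / 6"
  using measure_lebesgue_affine[of a 0 unit_simplex] assms
  by (simp add: measure_unit_simplex flip: scaled_unit_simplex_eq)

section \<open>The difference of two scaled simplices\<close>

definition simplex_difference :: "real \<Rightarrow> real \<Rightarrow> (real^3) set" where
  "simplex_difference a b = {a *\<^sub>R x - b *\<^sub>R y | x y. x \<in> unit_simplex \<and> y \<in> unit_simplex}"

lemma compact_simplex_difference: "compact (simplex_difference a b)"
proof -
  have "simplex_difference a b
    = {x - y | x y. x \<in> (*\<^sub>R) a ` unit_simplex \<and> y \<in> (*\<^sub>R) b ` unit_simplex}"
    unfolding simplex_difference_def by blast
  thus ?thesis
    by (auto intro!: compact_differences compact_scaling compact_unit_simplex)
qed

text \<open>Subtracting a common part from both minuend and subtrahend, one may assume them to be the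
  positive and the negative part of the difference.\<close>

lemma simplex_difference_eq:
  assumes "0 \<le> a" "0 \<le> b"
  shows "simplex_difference a b
    = {z. max (z $ 1) 0 + max (z $ 2) 0 + max (z $ 3) 0 \<le> a \<and>
          max (- z $ 1) 0 + max (- z $ 2) 0 + max (- z $ 3) 0 \<le> b}" (is "_ = ?R")
proof -
  define Q where "Q = (\<lambda>a. {x::real^3. 0 \<le> x $ 1 \<and> 0 \<le> x $ 2 \<and> 0 \<le> x $ 3 \<and> x $ 1 + x $ 2 + x $ 3 \<le> a})"
  have "simplex_difference a b = {x - y | x y. x \<in> (*\<^sub>R) a ` unit_simplex \<and> y \<in> (*\<^sub>R) b ` unit_simplex}"
    unfolding simplex_difference_def by blast
  also have "\<dots> = {x - y | x y. x \<in> Q a \<and> y \<in> Q b}"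
    using assms by (simp only: Q_def scaled_unit_simplex_eq)
  also have "\<dots> = ?R"
  proof (intro equalityI subsetI)
    fix z assume "z \<in> {x - y | x y. x \<in> Q a \<and> y \<in> Q b}"
    then obtain x y where z: "z = x - y" and "x \<in> Q a" "y \<in> Q b" by auto
    moreover have "max (z $ i) 0 \<le> x $ i \<and> max (- z $ i) 0 \<le> y $ i" if "0 \<le> x $ i" "0 \<le> y $ i" for i
      using that z by auto
    ultimately have "max (z $ i) 0 \<le> x $ i \<and> max (- z $ i) 0 \<le> y $ i" if "i \<in> {1, 2, 3}" for i
      using that by (auto simp: Q_def)
    from this[of 1] this[of 2] this[of 3] \<open>x \<in> Q a\<close> \<open>y \<in> Q b\<close> show "z \<in> ?R"
      by (simp add: Q_def del: max.bounded_iff)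
  next
    fix z assume z: "z \<in> ?R"
    have "(\<chi> i. max (z $ i) 0) \<in> Q a" "(\<chi> i. max (- z $ i) 0) \<in> Q b"
      using z by (auto simp: Q_def)
    moreover have "z = (\<chi> i. max (z $ i) 0) - (\<chi> i. max (- z $ i) 0)"
      by (auto simp: vec_eq_iff)
    ultimately show "z \<in> {x - y | x y. x \<in> Q a \<and> y \<in> Q b}" by blast
  qed
  finally show ?thesis .
qed

lemma image_uminus_Collect:
  fixes P :: "'a::group_add \<Rightarrow> bool"
  shows "uminus ` {x. P x} = {x. P (- x)}"
  by (auto intro: rev_image_eqI)

text \<open>There is one piece per sign pattern: the two constant patterns give
  \<open>a ^ 3 / 6\<close> and \<open>b ^ 3 / 6\<close>, and the mixed ones give three prisms of
  volume \<open>a\<^sup>2 * b / 2\<close> and three of volume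
  \<open>a * b\<^sup>2 / 2\<close>.\<close>

lemma measure_simplex_difference:
  assumes ab: "0 \<le> a" "0 \<le> b"
  shows "measure lebesgue (simplex_difference a b) = (a ^ 3 + 9 * a\<^sup>2 * b + 9 * a * b\<^sup>2 + b ^ 3) / 6"
proof -
  define D where "D = simplex_difference a b"
  define P N where "P = (\<lambda>i. {x::real^3. 0 \<le> x $ i})" and "N = (\<lambda>i. {x::real^3. x $ i \<le> 0})"
  define m where "m = measure (lebesgue :: (real^3) measure)"
  have cl: "closed (P i)" "closed (N i)" for i
    by (auto simp: P_def N_def closed_halfspace_component_le_cart closed_halfspace_component_ge_cart)
  have D: "compact D" by (simp add: D_def compact_simplex_difference)
  have split: "m A = m (A \<inter> P i) + m (A \<inter> N i)" if "compact A" for A i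
    unfolding m_def P_def N_def using measure_split_component[OF that] .
  have "m D = m (D \<inter> P 1) + m (D \<inter> N 1)"
    by (rule split) (rule D)
  also have "\<dots> = m (D \<inter> P 1 \<inter> P 2) + m (D \<inter> P 1 \<inter> N 2) + (m (D \<inter> N 1 \<inter> P 2) + m (D \<inter> N 1 \<inter> N 2))"
    by (intro arg_cong2[where f = "(+)"] split compact_Int_closed D cl)
  also have "\<dots> = m (D \<inter> P 1 \<inter> P 2 \<inter> P 3) + m (D \<inter> P 1 \<inter> P 2 \<inter> N 3)
     + (m (D \<inter> P 1 \<inter> N 2 \<inter> P 3) + m (D \<inter> P 1 \<inter> N 2 \<inter> N 3))
     + ((m (D \<inter> N 1 \<inter> P 2 \<inter> P 3) + m (D \<inter> N 1 \<inter> P 2 \<inter> N 3))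
     + (m (D \<inter> N 1 \<inter> N 2 \<inter> P 3) + m (D \<inter> N 1 \<inter> N 2 \<inter> N 3)))"
    by (intro arg_cong2[where f = "(+)"] split compact_Int_closed D cl)
  finally have sum: "m D = \<dots>" .
  note D_eq = D_def simplex_difference_eq[OF ab] P_def N_def image_uminus_Collect
  let ?Q = "\<lambda>a. {x::real^3. 0 \<le> x $ 1 \<and> 0 \<le> x $ 2 \<and> 0 \<le> x $ 3 \<and> x $ 1 + x $ 2 + x $ 3 \<le> a}"
  \<comment> \<open>On each octant every \<open>max\<close> reduces to 0 or to a coordinate up to
    sign. With two negative coordinates, reflection yields a prism with \<open>a\<close> and
    \<open>b\<close> exchanged.\<close>
  have pieces: "D \<inter> P 1 \<inter> P 2 \<inter> P 3 = ?Q a"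
       "D \<inter> N 1 \<inter> N 2 \<inter> N 3 = uminus ` ?Q b"
       "D \<inter> P 1 \<inter> P 2 \<inter> N 3 = prism 1 2 3 a b"
       "D \<inter> P 1 \<inter> N 2 \<inter> P 3 = prism 1 3 2 a b"
       "D \<inter> N 1 \<inter> P 2 \<inter> P 3 = prism 2 3 1 a b"
       "D \<inter> P 1 \<inter> N 2 \<inter> N 3 = uminus ` prism 2 3 1 b a"
       "D \<inter> N 1 \<inter> P 2 \<inter> N 3 = uminus ` prism 1 3 2 b a"
       "D \<inter> N 1 \<inter> N 2 \<inter> P 3 = uminus ` prism 1 2 3 b a"
    unfolding D_eq prism_def using ab by (safe; simp add: max_absorb1 max_absorb2)+
  have "m D = (a ^ 3 + 9 * a\<^sup>2 * b + 9 * a * b\<^sup>2 + b ^ 3) / 6"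
    unfolding sum pieces unfolding m_def measure_uminus_image
      ab[THEN measure_scaled_unit_simplex]
    using UNIV_3 ab by (simp add: measure_prism insert_commute field_simps)
  thus ?thesis unfolding m_def D_def .
qed

section \<open>Regular tetrahedra as affine images of the simplex\<close>

text \<open>Law of cosines; it supplies the off-diagonal Gram entries of the edges at a
  vertex.\<close>

lemma dist_eq_inner_diff:
  fixes p q r :: "'a::real_inner"
  assumes "dist p r = s" "dist q r = s" "dist p q = s"
  shows "(p - r) \<bullet> (q - r) = s\<^sup>2 / 2"
proof -
  have "(dist p q)\<^sup>2 = (dist p r)\<^sup>2 + (dist q r)\<^sup>2 - 2 * ((p - r) \<bullet> (q - r))"
    by (simp add: dist_norm power2_norm_eq_inner inner_diff_left inner_diff_right inner_commute)
  thus ?thesis using assms by simp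
qed

text \<open>The map sends the origin and the unit vectors to the four vertices. It is injective
  because equidistance makes the Gram matrix of the edges at \<open>v0\<close> positive
  definite.\<close>

lemma regular_tetrahedron_affine_image:
  assumes "regular_tetrahedron s T"
  obtains v and f :: "real^3 \<Rightarrow> real^3"
  where "linear f" "inj f" "T = (+) v ` f ` unit_simplex"
proof -
  obtain V where V: "s > 0" "card V = 4" "\<And>p q. p \<in> V \<Longrightarrow> q \<in> V \<Longrightarrow> p \<noteq> q \<Longrightarrow> dist p q = s"
    "T = convex hull V"
    using assms unfolding regular_tetrahedron_def by auto
  have "card V = Suc (Suc (Suc (Suc 0)))" using V(2) by simp
  then obtain v0 v1 v2 v3 where v: "V = {v0, v1, v2, v3}" "distinct [v0, v1, v2, v3]"
    by (auto simp: card_Suc_eq)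
  define f :: "real^3 \<Rightarrow> real^3" where
    "f = (\<lambda>x. x $ 1 *\<^sub>R (v1 - v0) + x $ 2 *\<^sub>R (v2 - v0) + x $ 3 *\<^sub>R (v3 - v0))"
  have lin: "linear f"
    by (rule linearI) (auto simp: f_def algebra_simps)
  have gram: "(p - v0) \<bullet> (q - v0) = (if p = q then s\<^sup>2 else s\<^sup>2 / 2)"
    if "p \<in> {v1, v2, v3}" "q \<in> {v1, v2, v3}" for p q
  proof (cases "p = q")
    case True
    have "(dist p v0)\<^sup>2 = s\<^sup>2" using that v V(3) by auto
    thus ?thesis using True by (simp add: dist_norm power2_norm_eq_inner)
  next
    case False
    moreover from False have "dist p v0 = s" "dist q v0 = s" "dist p q = s"
      using that v V(3) by auto
    ultimately show ?thesis by (simp add: dist_eq_inner_diff)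
  qed
  have distinct: "v1 \<noteq> v2" "v2 \<noteq> v1" "v1 \<noteq> v3" "v3 \<noteq> v1" "v2 \<noteq> v3" "v3 \<noteq> v2"
    using v(2) by auto
  have "x = 0" if "f x = 0" for x
  proof -
    \<comment> \<open>The Gram entries give \<open>s\<^sup>2\<close> times the sum of all squares
      and pairwise products of the coordinates; written as a sum of squares, it vanishes only at
      0.\<close>
    have "f x \<bullet> f x = s\<^sup>2 / 2 * ((x $ 1)\<^sup>2 + (x $ 2)\<^sup>2 + (x $ 3)\<^sup>2 + (x $ 1 + x $ 2 + x $ 3)\<^sup>2)"
      using distinct by (simp add: f_def inner_add_left inner_add_right gram)
        (simp add: power2_eq_square algebra_simps)
    hence "(x $ 1)\<^sup>2 + (x $ 2)\<^sup>2 + (x $ 3)\<^sup>2 + (x $ 1 + x $ 2 + x $ 3)\<^sup>2 = 0"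
      using that V(1) by simp
    hence "x $ 1 = 0 \<and> x $ 2 = 0 \<and> x $ 3 = 0"
      by (simp add: add_nonneg_eq_0_iff)
    thus "x = 0" by (simp add: vec_eq_iff forall_3)
  qed
  hence inj: "inj f" using lin linear_injective_0 by blast
  have B: "(Basis :: (real^3) set) = {axis 1 1, axis 2 1, axis 3 1}"
    by (auto simp: Basis_vec_def) (metis exhaust_3)
  have "f 0 = 0" "f (axis 1 1) = v1 - v0" "f (axis 2 1) = v2 - v0" "f (axis 3 1) = v3 - v0"
    by (simp_all add: f_def axis_def)
  \<comment> \<open>Matching the vertices suffices, since convex hulls commute with linear maps and
    translations.\<close>
  hence "V = (+) v0 ` f ` insert 0 Basis"
    by (simp add: B v)
  hence "T = (+) v0 ` f ` unit_simplex"
    unfolding V unit_simplex_def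
    by (simp only: convex_hull_translation convex_hull_linear_image[OF lin])
  with lin inj show ?thesis by (rule that)
qed

section \<open>The volume ratio as a cubic and its maximum\<close>

text \<open>Up to translation, numerator and denominator are images of
  \<open>simplex_difference a b\<close> and \<open>unit_simplex\<close> under the same linear map,
  so the determinant cancels.\<close>

lemma volume_ratio_regular_tetrahedron:
  assumes "regular_tetrahedron s T" "a \<in> {0..1}"
  shows "volume_ratio T a = (- 11 * a ^ 3 + 3 * a\<^sup>2 + 15 * a + 1) / 8"
proof -
  obtain v and f :: "real^3 \<Rightarrow> real^3" where
    f: "linear f" "inj f" and T: "T = (+) v ` f ` unit_simplex"
    using regular_tetrahedron_affine_image[OF assms(1)] .
  define b where "b = (1 - a) / 2"
  have eq: "a *\<^sub>R (v + f x) + b *\<^sub>R (- (v + f y)) = (a - b) *\<^sub>R v + f (a *\<^sub>R x - b *\<^sub>R y)" for x y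
    by (simp add: linear_diff[OF f(1)] linear_cmul[OF f(1)] algebra_simps)
  have "scaled_minkowski_sum a T b (uminus ` T)
    = {a *\<^sub>R (v + f x) + b *\<^sub>R (- (v + f y)) | x y. x \<in> unit_simplex \<and> y \<in> unit_simplex}"
    unfolding scaled_minkowski_sum_def T by blast
  also have "\<dots> = (+) ((a - b) *\<^sub>R v) ` f ` simplex_difference a b"
    unfolding eq simplex_difference_def by blast
  finally have sum: "measure lebesgue (scaled_minkowski_sum a T b (uminus ` T))
    = \<bar>det (matrix f)\<bar> * measure lebesgue (simplex_difference a b)"
    by (simp add: measure_translation measure_linear_image[OF f(1)] lmeasurable_compact
        compact_simplex_difference)
  have T6: "measure lebesgue T = \<bar>det (matrix f)\<bar> / 6"
    by (simp add: T measure_translation measure_linear_image[OF f(1)] lmeasurable_compact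
        compact_unit_simplex measure_unit_simplex)
  have "det (matrix f) \<noteq> 0" using f by (simp add: det_nz_iff_inj)
  moreover have "0 \<le> a" "0 \<le> b" using assms(2) by (auto simp: b_def)
  ultimately have "volume_ratio T a = a ^ 3 + 9 * a\<^sup>2 * b + 9 * a * b\<^sup>2 + b ^ 3"
    unfolding volume_ratio_def b_def[symmetric] sum T6 by (simp add: measure_simplex_difference)
  thus ?thesis
    by (simp add: b_def power2_eq_square power3_eq_cube field_simps)
qed

theorem theorem2:
  fixes T :: "(real ^ 3) set" and a0 :: real
  assumes "regular_tetrahedron 1 T"
    and "a0 = (1 + 2 * sqrt 14) / 11"
  shows "a0 \<in> {0..1} \<and>
         (\<forall>a\<in>{0..1}. volume_ratio T a \<le> volume_ratio T a0) \<and>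
         \<bar>a0 - 0.77121003\<bar> \<le> 1 / 10 ^ 6 \<and>
         \<bar>volume_ratio T a0 - 1.1633587\<bar> \<le> 1 / 10 ^ 6"
proof -
  \<comment> \<open>This says that the derivative of the cubic vanishes at
    \<open>a0\<close>.\<close>
  have crit: "11 * a0\<^sup>2 = 2 * a0 + 5"
    by (simp add: assms(2) power2_eq_square field_simps)
  \<comment> \<open>Seven decimals of the root place \<open>a0\<close> in an interval of length
    \<open>5 / 10 ^ 7\<close>, narrow enough for both numerical claims.\<close>
  have "3.7416573 \<le> sqrt 14" "sqrt 14 \<le> 3.7416574"
    by (rule real_le_rsqrt real_le_lsqrt; simp add: power2_eq_square)+
  hence bnd: "0.771210 \<le> a0" "a0 \<le> 0.7712105"
    unfolding assms(2) by simp_all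
  have a0: "a0 \<in> {0..1}" using bnd by auto
  have cubic: "121 * a0 ^ 3 = 59 * a0 + 10"
    using crit by algebra
  have val: "volume_ratio T a0 = (- 11 * a0 ^ 3 + 3 * a0\<^sup>2 + 15 * a0 + 1) / 8"
    using volume_ratio_regular_tetrahedron[OF assms(1) a0] .
  have "volume_ratio T a \<le> volume_ratio T a0" if "a \<in> {0..1}" for a
  proof -
    \<comment> \<open>Since \<open>a0\<close> is a double root of the difference, the sum of the
      roots, \<open>3 / 11\<close>, determines the linear factor. It is positive because
      \<open>a \<ge> 0\<close> and \<open>22 * a0 > 3\<close>.\<close>
    have "(- 11 * a0 ^ 3 + 3 * a0\<^sup>2 + 15 * a0 + 1) - (- 11 * a ^ 3 + 3 * a\<^sup>2 + 15 * a + 1)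
      = (a - a0)\<^sup>2 * (11 * a + 22 * a0 - 3)"
      using crit by algebra
    moreover have "0 \<le> (a - a0)\<^sup>2 * (11 * a + 22 * a0 - 3)"
      using that bnd by (intro mult_nonneg_nonneg) auto
    ultimately show ?thesis
      unfolding val volume_ratio_regular_tetrahedron[OF assms(1) that] by simp
  qed
  moreover have "\<bar>a0 - 0.77121003\<bar> \<le> 1 / 10 ^ 6"
    using bnd unfolding abs_le_iff by simp
  \<comment> \<open>Reducing modulo the quadratic equation of \<open>a0\<close> makes the value
    linear in \<open>a0\<close>, so the bounds on \<open>a0\<close> transfer directly.\<close>
  moreover have "volume_ratio T a0 = (14 * a0 + 2) / 11"
    unfolding val using crit cubic by algebra
  hence "\<bar>volume_ratio T a0 - 1.1633587\<bar> \<le> 1 / 10 ^ 6"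
    using bnd unfolding abs_le_iff by simp
  ultimately show ?thesis using a0 by blast
qed

end
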